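(* Let $n\geq 2$ be an integer and let $\mathbb{F}_q$ be a finite field of characteristic $p\geq 5$. Let $W_2(\mathbb{F}_q)$ be the ring of ($p$-typical) Witt vectors of length two over $\mathbb{F}_q$. Then the groups $\mathrm{SL}_n(W_2(\mathbb{F}_q))$ and $\mathrm{SL}_n(\mathbb{F}_q[t]/t^2)$ are not isomorphic. *)

theory Defs
  imports
    "HOL-Computational_Algebra.Computational_Algebra"
    "HOL-Algebra.Group"
    "Jordan_Normal_Form.Char_Poly"
begin

section \<open>Witt vectors of length two\<close>

text \<open>
  The integral polynomial (1/p) * ((X + Y)^p - X^p - Y^p). The natural-number division is exact
  for prime p, see \<open>add_power_prime_eq\<close>.
\<close>

definition witt_carry :: "nat \<Rightarrow> 'r::comm_semiring_1 \<Rightarrow> 'r \<Rightarrow> 'r" where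
  "witt_carry p x y = (\<Sum>i\<in>{1..<p}. of_nat ((p choose i) div p) * x ^ i * y ^ (p - i))"

text \<open>
  The ghost components of (x0, x1) are x0 and x0^p + p * x1. The universal p-typical Witt
  polynomials for addition and multiplication in length two are characterised by the requirement
  that they become componentwise addition and multiplication on ghost components
  (\<open>ghost1_add\<close> and \<open>ghost1_mult\<close> below).
\<close>

definition ghost1 :: "nat \<Rightarrow> 'r::comm_ring_1 \<times> 'r \<Rightarrow> 'r" where
  "ghost1 p x = fst x ^ p + of_nat p * snd x"

definition witt_add :: "nat \<Rightarrow> 'r::comm_ring_1 \<times> 'r \<Rightarrow> 'r \<times> 'r \<Rightarrow> 'r \<times> 'r" where
  "witt_add p x y = (fst x + fst y, snd x + snd y - witt_carry p (fst x) (fst y))"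

definition witt_mult :: "nat \<Rightarrow> 'r::comm_ring_1 \<times> 'r \<Rightarrow> 'r \<times> 'r \<Rightarrow> 'r \<times> 'r" where
  "witt_mult p x y =
     (fst x * fst y, fst x ^ p * snd y + snd x * fst y ^ p + of_nat p * snd x * snd y)"

lemma add_power_prime_eq:
  fixes x y :: "'r::comm_semiring_1"
  assumes p: "prime p"
  shows "(x + y) ^ p = x ^ p + y ^ p + of_nat p * witt_carry p x y"
proof -
  have p0: "p > 0" using p prime_gt_0_nat by blast
  have split: "{..p} = insert 0 (insert p {1..<p})" using p0 by auto
  have "(x + y) ^ p = (\<Sum>k\<le>p. of_nat (p choose k) * x ^ k * y ^ (p - k))"
    by (rule binomial_ring)
  also have "\<dots> = x ^ p + y ^ p + (\<Sum>k\<in>{1..<p}. of_nat (p choose k) * x ^ k * y ^ (p - k))"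
    using p0 by (simp add: split add.assoc add.left_commute)
  also have "(\<Sum>k\<in>{1..<p}. of_nat (p choose k) * x ^ k * y ^ (p - k)) =
    of_nat p * witt_carry p x y"
    unfolding witt_carry_def sum_distrib_left
  proof (rule sum.cong)
    fix k assume k: "k \<in> {1..<p}"
    have "p dvd (p choose k)" using k p by (intro dvd_choose_prime) auto
    hence "p choose k = p * ((p choose k) div p)" by simp
    hence "(of_nat (p choose k) :: 'r) = of_nat p * of_nat ((p choose k) div p)"
      by (simp only: of_nat_mult [symmetric])
    thus "of_nat (p choose k) * x ^ k * y ^ (p - k) =
      of_nat p * (of_nat ((p choose k) div p) * x ^ k * y ^ (p - k))"
      by (simp add: mult.assoc)
  qed simp
  finally show ?thesis .
qed

lemma ghost1_add: "prime p \<Longrightarrow> ghost1 p (witt_add p x y) = ghost1 p x + ghost1 p y"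
  by (simp add: ghost1_def witt_add_def add_power_prime_eq algebra_simps)

lemma ghost1_mult: "ghost1 p (witt_mult p x y) = ghost1 p x * ghost1 p y"
  by (simp add: ghost1_def witt_mult_def power_mult_distrib algebra_simps)

lemma witt_carry_commute: "witt_carry p x y = witt_carry p y x"
proof -
  have "witt_carry p x y =
    (\<Sum>i\<in>{1..<p}. of_nat ((p choose (p - i)) div p) * x ^ (p - i) * y ^ i)"
    unfolding witt_carry_def
    by (rule sum.reindex_bij_witness[of _ "\<lambda>i. p - i" "\<lambda>i. p - i"]) auto
  also have "\<dots> = witt_carry p y x"
    unfolding witt_carry_def
    by (intro sum.cong refl) (auto simp: binomial_symmetric[symmetric] mult_ac)
  finally show ?thesis .
qed

lemma witt_carry_0_left [simp]: "witt_carry p 0 y = 0"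
  by (auto simp: witt_carry_def power_0_left intro!: sum.neutral)

lemma witt_carry_scale: "witt_carry p (a * x) (a * y) = a ^ p * witt_carry p x y"
  unfolding witt_carry_def sum_distrib_left
proof (rule sum.cong)
  fix i assume "i \<in> {1..<p}"
  hence "a ^ p = a ^ i * a ^ (p - i)" by (simp flip: power_add)
  thus "of_nat ((p choose i) div p) * (a * x) ^ i * (a * y) ^ (p - i) =
      a ^ p * (of_nat ((p choose i) div p) * x ^ i * y ^ (p - i))"
    by (simp add: power_mult_distrib mult_ac)
qed simp

lemma (in comm_ring_hom) hom_witt_carry:
  "hom (witt_carry p x y) = witt_carry p (hom x) (hom y)"
  by (simp add: witt_carry_def hom_sum hom_mult hom_power hom_of_nat)

lemma witt_carry_cocycle_char_0:
  fixes x y z :: "'r::{idom,ring_char_0}"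
  assumes p: "prime p"
  shows "witt_carry p x y + witt_carry p (x + y) z = witt_carry p y z + witt_carry p x (y + z)"
proof -
  have "(x + y + z) ^ p = (x + (y + z)) ^ p" by (simp add: add.assoc)
  hence "of_nat p * (witt_carry p x y + witt_carry p (x + y) z) =
      of_nat p * (witt_carry p y z + witt_carry p x (y + z))"
    unfolding add_power_prime_eq[OF p, of "x + y" z] add_power_prime_eq[OF p, of x y]
      add_power_prime_eq[OF p, of x "y + z"] add_power_prime_eq[OF p, of y z]
    by (simp add: algebra_simps)
  thus ?thesis using p by (auto simp: prime_nat_iff)
qed

lemma comm_ring_hom_eval:
  assumes "comm_ring_hom (h :: 'a::comm_ring_1 \<Rightarrow> 'b::comm_ring_1)"
  shows "comm_ring_hom (\<lambda>q. poly (map_poly h q) x)"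
proof -
  interpret comm_ring_hom h by fact
  interpret m: map_poly_comm_ring_hom h ..
  show ?thesis
    by unfold_locales (auto simp: m.hom_add m.hom_mult)
qed

text \<open>The identity is inherited from the polynomial ring Z[X,Y,Z].\<close>

lemma witt_carry_cocycle:
  fixes x y z :: "'r::comm_ring_1"
  assumes p: "prime p"
  shows "witt_carry p x y + witt_carry p (x + y) z = witt_carry p y z + witt_carry p x (y + z)"
proof -
  define h1 where "h1 = (\<lambda>q::int poly. poly (map_poly (of_int :: int \<Rightarrow> 'r) q) x)"
  define h2 where "h2 = (\<lambda>q. poly (map_poly h1 q) y)"
  define h3 where "h3 = (\<lambda>q. poly (map_poly h2 q) z)"
  have c0: "comm_ring_hom (of_int :: int \<Rightarrow> 'r)" by unfold_locales auto
  have c1: "comm_ring_hom h1" unfolding h1_def by (rule comm_ring_hom_eval[OF c0])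
  have c2: "comm_ring_hom h2" unfolding h2_def by (rule comm_ring_hom_eval[OF c1])
  have c3: "comm_ring_hom h3" unfolding h3_def by (rule comm_ring_hom_eval[OF c2])
  interpret h1: comm_ring_hom h1 by fact
  interpret h2: comm_ring_hom h2 by fact
  interpret h3: comm_ring_hom h3 by fact
  have h1X: "h1 [:0, 1:] = x" by (simp add: h1_def map_poly_pCons)
  have h2C: "h2 [:c:] = h1 c" for c by (cases "c = 0") (simp_all add: h2_def map_poly_pCons)
  have h2X: "h2 [:0, 1:] = y" by (simp add: h2_def map_poly_pCons)
  have h3C: "h3 [:c:] = h2 c" for c by (cases "c = 0") (simp_all add: h3_def map_poly_pCons)
  have h3X: "h3 [:0, 1:] = z" by (simp add: h3_def map_poly_pCons)
  define X Y Z :: "int poly poly poly"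
    where "X = [:[:[:0, 1:]:]:]" and "Y = [:[:0, 1:]:]" and "Z = [:0, 1:]"
  have XYZ: "h3 X = x" "h3 Y = y" "h3 Z = z"
    by (simp_all add: X_def Y_def Z_def h1X h2C h2X h3C h3X)
  have "h3 (witt_carry p X Y + witt_carry p (X + Y) Z) =
        h3 (witt_carry p Y Z + witt_carry p X (Y + Z))"
    by (simp add: witt_carry_cocycle_char_0[OF p])
  thus ?thesis by (simp add: h3.hom_add h3.hom_witt_carry XYZ)
qed

text \<open>
  Over a ring of prime characteristic p the ring structure is the p-typical one for that same p.
\<close>

datatype 'a witt2 = Witt2 (wcomps: "'a \<times> 'a")

instantiation witt2 :: (comm_ring_prime_char) comm_ring_1
begin

definition zero_witt2 :: "'a witt2" where "0 = Witt2 (0, 0)"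

definition one_witt2 :: "'a witt2" where "1 = Witt2 (1, 0)"

definition plus_witt2 :: "'a witt2 \<Rightarrow> 'a witt2 \<Rightarrow> 'a witt2" where
  "x + y = Witt2 (witt_add CHAR('a) (wcomps x) (wcomps y))"

definition times_witt2 :: "'a witt2 \<Rightarrow> 'a witt2 \<Rightarrow> 'a witt2" where
  "x * y = Witt2 (witt_mult CHAR('a) (wcomps x) (wcomps y))"

text \<open>The carry term is needed for p = 2 only.\<close>

definition uminus_witt2 :: "'a witt2 \<Rightarrow> 'a witt2" where
  "- x = (let (a, b) = wcomps x in Witt2 (- a, - b + witt_carry CHAR('a) a (- a)))"

definition minus_witt2 :: "'a witt2 \<Rightarrow> 'a witt2 \<Rightarrow> 'a witt2" where
  "x - y = x + - (y :: 'a witt2)"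

instance
proof
  let ?p = "CHAR('a)"
  have p: "prime ?p" by simp
  have p0: "?p > 0" using p prime_gt_0_nat by blast
  fix x y z :: "'a witt2"
  obtain a b where x: "x = Witt2 (a, b)" by (metis surj_pair witt2.exhaust)
  obtain c d where y: "y = Witt2 (c, d)" by (metis surj_pair witt2.exhaust)
  obtain e f where z: "z = Witt2 (e, f)" by (metis surj_pair witt2.exhaust)
  note defs = x y z zero_witt2_def one_witt2_def plus_witt2_def times_witt2_def uminus_witt2_def
    minus_witt2_def witt_add_def witt_mult_def
  show "x + y + z = x + (y + z)"
    using witt_carry_cocycle[OF p, of a c e] by (simp add: defs algebra_simps)
  show "x + y = y + x"
    by (simp add: defs algebra_simps witt_carry_commute[of _ c a])
  show "0 + x = x" by (simp add: defs)
  show "- x + x = 0" by (simp add: defs witt_carry_commute[of _ "- a" a])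
  show "x - y = x + - y" by (simp add: defs)
  show "x * y * z = x * (y * z)"
    by (simp add: defs power_mult_distrib algebra_simps)
  show "x * y = y * x" by (simp add: defs algebra_simps)
  show "1 * x = x" using p0 by (simp add: defs)
  have frob: "(a + c) ^ ?p = a ^ ?p + c ^ ?p"
    by (simp add: add_power_prime_eq[OF p])
  show "(x + y) * z = x * z + y * z"
    using witt_carry_scale[of ?p e a c]
    by (simp add: defs frob algebra_simps)
  show "(0 :: 'a witt2) \<noteq> 1" by (simp add: defs)
qed

end

section \<open>The truncated polynomial ring\<close>

quotient_type (overloaded) 'a poly_mod_t2 =
  "'a::comm_ring_1 poly" / "\<lambda>f g. [:0, 1:] ^ 2 dvd f - g"
proof (rule equivpI)
  show "reflp (\<lambda>f g :: 'a poly. [:0, 1:] ^ 2 dvd f - g)"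
    by (rule reflpI) simp
  show "symp (\<lambda>f g :: 'a poly. [:0, 1:] ^ 2 dvd f - g)"
  proof (rule sympI)
    fix f g :: "'a poly"
    assume "[:0, 1:] ^ 2 dvd f - g"
    hence "[:0, 1:] ^ 2 dvd - (f - g)" by (simp only: dvd_minus_iff)
    thus "[:0, 1:] ^ 2 dvd g - f" by (simp only: minus_diff_eq)
  qed
  show "transp (\<lambda>f g :: 'a poly. [:0, 1:] ^ 2 dvd f - g)"
  proof (rule transpI)
    fix f g h :: "'a poly"
    assume "[:0, 1:] ^ 2 dvd f - g" "[:0, 1:] ^ 2 dvd g - h"
    hence "[:0, 1:] ^ 2 dvd (f - g) + (g - h)" by (rule dvd_add)
    thus "[:0, 1:] ^ 2 dvd f - h" by simp
  qed
qed

instantiation poly_mod_t2 :: (comm_ring_1) comm_ring_1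
begin

lift_definition zero_poly_mod_t2 :: "'a poly_mod_t2" is "0" .

lift_definition one_poly_mod_t2 :: "'a poly_mod_t2" is "1" .

lift_definition plus_poly_mod_t2 :: "'a poly_mod_t2 \<Rightarrow> 'a poly_mod_t2 \<Rightarrow> 'a poly_mod_t2"
  is "(+)"
proof -
  fix f g h k :: "'a poly"
  assume "[:0, 1:] ^ 2 dvd f - g" "[:0, 1:] ^ 2 dvd h - k"
  hence "[:0, 1:] ^ 2 dvd (f - g) + (h - k)" by (rule dvd_add)
  thus "[:0, 1:] ^ 2 dvd f + h - (g + k)" by (simp add: algebra_simps)
qed

lift_definition minus_poly_mod_t2 :: "'a poly_mod_t2 \<Rightarrow> 'a poly_mod_t2 \<Rightarrow> 'a poly_mod_t2"
  is "(-)"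
proof -
  fix f g h k :: "'a poly"
  assume "[:0, 1:] ^ 2 dvd f - g" "[:0, 1:] ^ 2 dvd h - k"
  hence "[:0, 1:] ^ 2 dvd (f - g) - (h - k)" by (rule dvd_diff)
  thus "[:0, 1:] ^ 2 dvd f - h - (g - k)" by (simp add: algebra_simps)
qed

lift_definition uminus_poly_mod_t2 :: "'a poly_mod_t2 \<Rightarrow> 'a poly_mod_t2" is "uminus"
proof -
  fix f g :: "'a poly"
  assume "[:0, 1:] ^ 2 dvd f - g"
  hence "[:0, 1:] ^ 2 dvd - (f - g)" by (simp only: dvd_minus_iff)
  thus "[:0, 1:] ^ 2 dvd - f - - g" by simp
qed

lift_definition times_poly_mod_t2 :: "'a poly_mod_t2 \<Rightarrow> 'a poly_mod_t2 \<Rightarrow> 'a poly_mod_t2"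
  is "(*)"
proof -
  fix f g h k :: "'a poly"
  assume "[:0, 1:] ^ 2 dvd f - g" "[:0, 1:] ^ 2 dvd h - k"
  hence "[:0, 1:] ^ 2 dvd (f - g) * h + g * (h - k)" by (intro dvd_add dvd_mult dvd_mult2)
  thus "[:0, 1:] ^ 2 dvd f * h - g * k" by (simp add: algebra_simps)
qed

instance
proof
  fix a b c :: "'a poly_mod_t2"
  show "a + b + c = a + (b + c)" by transfer (simp add: algebra_simps)
  show "a + b = b + a" by transfer (simp add: algebra_simps)
  show "0 + a = a" by transfer simp
  show "- a + a = 0" by transfer simp
  show "a - b = a + - b" by transfer simp
  show "a * b * c = a * (b * c)" by transfer (simp add: algebra_simps)
  show "a * b = b * a" by transfer (simp add: algebra_simps)
  show "1 * a = a" by transfer simp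
  show "(a + b) * c = a * c + b * c" by transfer (simp add: algebra_simps)
  show "(0 :: 'a poly_mod_t2) \<noteq> 1"
  proof (transfer, rule notI)
    assume "[:0, 1:] ^ 2 dvd (0 - 1 :: 'a poly)"
    then obtain q where "0 - 1 = [:0, 1:] ^ 2 * (q :: 'a poly)" unfolding dvd_def ..
    hence "poly (0 - 1) 0 = poly ([:0, 1:] ^ 2 * q) 0" by metis
    thus False by (simp add: power2_eq_square)
  qed
qed

end

section \<open>The special linear group\<close>

definition SL :: "nat \<Rightarrow> 'r::comm_ring_1 itself \<Rightarrow> 'r mat monoid" where
  "SL n R = \<lparr>carrier = {A \<in> carrier_mat n n. det A = 1}, mult = (*), one = 1\<^sub>m n\<rparr>"

lemma group_SL: "group (SL n TYPE('r::comm_ring_1))"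
proof (rule groupI)
  fix A :: "'r mat" assume "A \<in> carrier (SL n TYPE('r))"
  hence A: "A \<in> carrier_mat n n" "det A = 1" by (simp_all add: SL_def)
  note adj = adj_mat[OF A(1)]
  have "det (adj_mat A) * det A = det (adj_mat A * A)"
    by (rule det_mult[symmetric]) (use A adj in auto)
  also have "\<dots> = 1" using A adj by simp
  finally have "det (adj_mat A) = 1" using A by simp
  thus "\<exists>B\<in>carrier (SL n TYPE('r)). B \<otimes>\<^bsub>SL n TYPE('r)\<^esub> A = \<one>\<^bsub>SL n TYPE('r)\<^esub>"
    using A adj by (intro bexI[of _ "adj_mat A"]) (auto simp: SL_def)
qed (auto simp: SL_def det_mult[of _ n] assoc_mult_mat[of _ n n _ n _ n])

end

theory Submission
  imports Defs
begin

text \<open>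
  Let k be the finite field and p its characteristic. The two groups have different numbers of
  elements g with g ^ p = 1: the special linear group over the Witt vectors has strictly fewer.

  Both rings R are extensions of k by an ideal that squares to zero and is isomorphic to k as a
  module over k: for the dual numbers the ideal is generated by t, and for the Witt vectors it is
  generated by p, where the parametrisation by k involves the Frobenius map. This is all that the
  locale \<open>square_zero_extension\<close> records. It already determines how the solutions of g ^ p = 1
  lying above a fixed matrix u over k look once one solution A is known: the others are the
  A + \<iota> Y, where \<iota> embeds matrices over k into matrices over the ideal, and the conditions
  on Y are linear and involve u only. One says that the derivative of the p-th power map at u kills
  Y, the other says that the trace of the inverse of u times Y vanishes. So above each u there are
  either no solutions or a number of solutions which is the same for both rings
  (\<open>card_root_fibre\<close>).

  Over the dual numbers there is always a solution, because k embeds into them as the constants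
  (\<open>dual_root_fibre_nonempty\<close>). Over the Witt vectors there is none above the transvection
  u = 1 + E with E the elementary matrix at position (0,1). Indeed, if N is the elementary matrix
  over the Witt vectors, then every lift of u has the form 1 + N + \<iota> Y. Its p-th power is
  1 + p N + \<iota> D, where D, the derivative of the p-th power map at u in the direction Y, is a
  combination of Y, E Y + Y E and E Y E with the coefficients p, (p choose 2) and (p choose 3).
  All three vanish in k when p is at least 5, whereas p N = \<iota> E is nonzero
  (\<open>witt_root_fibre_empty\<close>). For p = 3 the coefficient (p choose 3) is 1, and the argument
  breaks down.
\<close>

section \<open>Powers of matrices\<close>

text \<open>
  The derivative of the m-th power map at u in the direction Y, that is, the sum of the products
  u ^ i * Y * u ^ (m - 1 - i) for i < m.
\<close>

fun power_deriv :: "nat \<Rightarrow> nat \<Rightarrow> 'r::comm_ring_1 mat \<Rightarrow> 'r mat \<Rightarrow> 'r mat" where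
  "power_deriv n 0 u Y = 0\<^sub>m n n"
| "power_deriv n (Suc m) u Y = power_deriv n m u Y * u + (u ^\<^sub>m m) * Y"

lemma power_deriv_carrier [simp]:
  "u \<in> carrier_mat n n \<Longrightarrow> Y \<in> carrier_mat n n \<Longrightarrow> power_deriv n m u Y \<in> carrier_mat n n"
  by (cases m) auto

lemma power_one_plus_square_zero:
  fixes N :: "'r::comm_ring_1 mat"
  assumes N: "N \<in> carrier_mat n n" and N2: "N * N = 0\<^sub>m n n"
  shows "(1\<^sub>m n + N) ^\<^sub>m m = 1\<^sub>m n + of_nat m \<cdot>\<^sub>m N"
proof (induction m)
  case 0
  show ?case using N by (intro eq_matI) auto
next
  case (Suc m)
  have "(1\<^sub>m n + N) ^\<^sub>m Suc m = (1\<^sub>m n + of_nat m \<cdot>\<^sub>m N) * (1\<^sub>m n + N)"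
    by (simp add: Suc)
  also have "\<dots> = (1\<^sub>m n + of_nat m \<cdot>\<^sub>m N) + (N + of_nat m \<cdot>\<^sub>m 0\<^sub>m n n)"
    using N by (simp add: add_mult_distrib_mat[of _ n n _ _ n] mult_add_distrib_mat[of _ n n _ n]
        mult_smult_assoc_mat[of _ n n _ n] N2)
  also have "\<dots> = 1\<^sub>m n + of_nat (Suc m) \<cdot>\<^sub>m N"
    using N by (intro eq_matI) (auto simp: algebra_simps)
  finally show ?case .
qed

lemma choose_3_Suc: "Suc m choose 3 = (m choose 3) + (m choose 2)"
  by (simp add: numeral_3_eq_3 numeral_2_eq_2)

lemma choose_2_Suc: "Suc m choose 2 = (m choose 2) + m"
  by (simp add: numeral_2_eq_2)

text \<open>
  In the sum of the (1 + N) ^ i * Y * (1 + N) ^ (m - 1 - i) both powers are linear in N, so N * Y * N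
  receives the coefficient that sums i * (m - 1 - i) over i < m, which is m choose 3.
\<close>

lemma power_deriv_one_plus_square_zero:
  fixes N Y :: "'r::comm_ring_1 mat"
  assumes N: "N \<in> carrier_mat n n" and N2: "N * N = 0\<^sub>m n n" and Y: "Y \<in> carrier_mat n n"
  shows "power_deriv n m (1\<^sub>m n + N) Y =
    of_nat m \<cdot>\<^sub>m Y + of_nat (m choose 2) \<cdot>\<^sub>m (N * Y + Y * N) + of_nat (m choose 3) \<cdot>\<^sub>m (N * Y * N)"
proof (induction m)
  case 0
  show ?case using N Y by (intro eq_matI) (auto simp: binomial_eq_0)
next
  case (Suc m)
  have NY: "N * Y \<in> carrier_mat n n" and YN: "Y * N \<in> carrier_mat n n"
    and NYN: "N * Y * N \<in> carrier_mat n n" using N Y by auto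
  have z1: "Y * N * N = 0\<^sub>m n n" using N Y N2 by (simp add: assoc_mult_mat[of _ n n _ n _ n])
  have z2: "N * (Y * N) * N = 0\<^sub>m n n"
    using N Y N2 by (simp add: assoc_mult_mat[of _ n n _ n _ n])
  let ?C2 = "of_nat (m choose 2) :: 'r" and ?C3 = "of_nat (m choose 3) :: 'r"
  have "power_deriv n (Suc m) (1\<^sub>m n + N) Y =
      (of_nat m \<cdot>\<^sub>m Y + ?C2 \<cdot>\<^sub>m (N * Y + Y * N) + ?C3 \<cdot>\<^sub>m (N * Y * N)) * (1\<^sub>m n + N)
      + (1\<^sub>m n + of_nat m \<cdot>\<^sub>m N) * Y"
    by (simp add: Suc power_one_plus_square_zero[OF N N2])
  also have "(1\<^sub>m n + of_nat m \<cdot>\<^sub>m N) * Y = Y + of_nat m \<cdot>\<^sub>m (N * Y)"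
    using N Y by (simp add: add_mult_distrib_mat[of _ n n _ _ n] mult_smult_assoc_mat[of _ n n _ n])
  also have "(of_nat m \<cdot>\<^sub>m Y + ?C2 \<cdot>\<^sub>m (N * Y + Y * N) + ?C3 \<cdot>\<^sub>m (N * Y * N)) * (1\<^sub>m n + N) =
      (of_nat m \<cdot>\<^sub>m Y + ?C2 \<cdot>\<^sub>m (N * Y + Y * N) + ?C3 \<cdot>\<^sub>m (N * Y * N)) +
      (of_nat m \<cdot>\<^sub>m (Y * N) + ?C2 \<cdot>\<^sub>m (N * Y * N + 0\<^sub>m n n) + ?C3 \<cdot>\<^sub>m 0\<^sub>m n n)"
    using N Y NY YN NYN
    by (simp add: add_mult_distrib_mat[of _ n n _ _ n] mult_add_distrib_mat[of _ n n _ n]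
        mult_smult_assoc_mat[of _ n n _ n] z1 z2)
  also have "\<dots> + (Y + of_nat m \<cdot>\<^sub>m (N * Y)) =
      of_nat (Suc m) \<cdot>\<^sub>m Y + of_nat (Suc m choose 2) \<cdot>\<^sub>m (N * Y + Y * N)
      + of_nat (Suc m choose 3) \<cdot>\<^sub>m (N * Y * N)"
    unfolding choose_3_Suc choose_2_Suc using N Y NY YN NYN
    by (intro eq_matI) (auto simp del: index_mult_mat(1) simp: algebra_simps)
  finally show ?case .
qed

text \<open>
  This is where the bound on the characteristic enters: 3 < p makes p divide p choose 3.
\<close>

lemma power_deriv_CHAR_eq_0:
  fixes N Y :: "'r::comm_ring_1 mat"
  assumes N: "N \<in> carrier_mat n n" and N2: "N * N = 0\<^sub>m n n" and Y: "Y \<in> carrier_mat n n"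
    and p: "prime CHAR('r)" "CHAR('r) \<ge> 5"
  shows "power_deriv n CHAR('r) (1\<^sub>m n + N) Y = 0\<^sub>m n n"
proof -
  have "CHAR('r) dvd (CHAR('r) choose 2)" "CHAR('r) dvd (CHAR('r) choose 3)"
    using p by (auto intro!: dvd_choose_prime)
  hence "of_nat (CHAR('r) choose 2) = (0 :: 'r)" "of_nat (CHAR('r) choose 3) = (0 :: 'r)"
    by (simp_all add: of_nat_eq_0_iff_char_dvd)
  thus ?thesis unfolding power_deriv_one_plus_square_zero[OF N N2 Y]
    using N Y by (intro eq_matI) (auto simp del: index_mult_mat(1))
qed

section \<open>Torsion over a square-zero extension\<close>

definition SL_roots :: "nat \<Rightarrow> nat \<Rightarrow> 'r::comm_ring_1 mat set" where
  "SL_roots n m = {A \<in> carrier_mat n n. det A = 1 \<and> A ^\<^sub>m m = 1\<^sub>m n}"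

text \<open>
  The tangent space at u of the scheme of solutions of det A = 1 and A ^ m = 1, when u is itself a
  solution. The inverse of u, which occurs in the derivative of the determinant, is then the power
  with exponent m - 1.
\<close>

definition tangent_roots :: "nat \<Rightarrow> nat \<Rightarrow> 'k::comm_ring_1 mat \<Rightarrow> 'k mat set" where
  "tangent_roots n m u = {Y \<in> carrier_mat n n. power_deriv n m u Y = 0\<^sub>m n n \<and>
     (\<Sum>i<n. ((u ^\<^sub>m (m - 1)) * Y) $$ (i, i)) = 0}"

text \<open>
  The kernel of proj is a copy of k as a module over the first ring, which acts on k through proj;
  the copy is embedded by incl. That products of two elements of
  the kernel vanish is a consequence of \<open>incl_proj\<close>, see \<open>incl_mult_incl\<close>.
\<close>

locale square_zero_extension =
  fixes proj :: "'r::comm_ring_1 \<Rightarrow> 'k::comm_ring_1" and incl :: "'k \<Rightarrow> 'r"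
  assumes proj_hom: "comm_ring_hom proj"
    and incl_add: "incl (x + y) = incl x + incl y"
    and incl_proj: "incl (x * proj r) = incl x * r"
    and inj_incl: "inj incl"
    and proj_eq_0_iff: "proj r = 0 \<longleftrightarrow> r \<in> range incl"
begin

sublocale proj: comm_ring_hom proj by (rule proj_hom)

lemma incl_0 [simp]: "incl 0 = 0"
  using incl_add[of 0 0] by simp

lemma incl_sum: "incl (sum f A) = (\<Sum>i\<in>A. incl (f i))"
  by (induction A rule: infinite_finite_induct) (auto simp: incl_add)

lemma incl_eq_iff [simp]: "incl x = incl y \<longleftrightarrow> x = y"
  using inj_incl by (auto dest: injD)

lemma incl_eq_0_iff [simp]: "incl x = 0 \<longleftrightarrow> x = 0"
  using incl_eq_iff[of x 0] by simp

lemma proj_incl [simp]: "proj (incl x) = 0"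
  using proj_eq_0_iff by blast

lemma incl_mult_incl [simp]: "incl x * incl y = 0"
  using incl_proj[of x "incl y"] by simp

abbreviation proj_mat :: "'r mat \<Rightarrow> 'k mat" where "proj_mat \<equiv> map_mat proj"
abbreviation incl_mat :: "'k mat \<Rightarrow> 'r mat" where "incl_mat \<equiv> map_mat incl"

lemma incl_mat_add:
  assumes "X \<in> carrier_mat n n" "Y \<in> carrier_mat n n"
  shows "incl_mat (X + Y) = incl_mat X + incl_mat Y"
  using assms by (intro eq_matI) (auto simp: incl_add)

lemma incl_mat_mult_right:
  assumes "Y \<in> carrier_mat n n" "A \<in> carrier_mat n n"
  shows "incl_mat (Y * proj_mat A) = incl_mat Y * A"
  using assms by (intro eq_matI) (auto simp: scalar_prod_def incl_sum incl_proj)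

lemma incl_mat_mult_left:
  assumes "Y \<in> carrier_mat n n" "A \<in> carrier_mat n n"
  shows "incl_mat (proj_mat A * Y) = A * incl_mat Y"
  using assms by (intro eq_matI) (auto simp: scalar_prod_def incl_sum incl_proj mult.commute[of "proj _"]
        mult.commute[of _ "incl _"])

lemma incl_mat_mult_incl_mat:
  assumes "X \<in> carrier_mat n n" "Y \<in> carrier_mat n n"
  shows "incl_mat X * incl_mat Y = 0\<^sub>m n n"
  using assms by (intro eq_matI) (auto simp: scalar_prod_def)

lemma incl_mat_eq_0_iff:
  assumes "Y \<in> carrier_mat n n"
  shows "incl_mat Y = 0\<^sub>m n n \<longleftrightarrow> Y = 0\<^sub>m n n"
  using assms by (auto simp: mat_eq_iff)

lemma proj_mat_plus_incl_mat:
  assumes "A \<in> carrier_mat n n" "Y \<in> carrier_mat n n"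
  shows "proj_mat (A + incl_mat Y) = proj_mat A"
  using assms by (intro eq_matI) (auto simp: proj.hom_add)

lemma same_proj_mat:
  assumes A: "A \<in> carrier_mat n n" and B: "B \<in> carrier_mat n n" and eq: "proj_mat B = proj_mat A"
  obtains Y where "Y \<in> carrier_mat n n" "B = A + incl_mat Y"
proof -
  have "\<exists>y. B $$ ij - A $$ ij = incl y" if "ij \<in> {..<n} \<times> {..<n}" for ij
  proof -
    have "proj (B $$ ij) = proj (A $$ ij)"
      using arg_cong[OF eq, of "\<lambda>M. M $$ ij"] A B that by (cases ij) auto
    hence "proj (B $$ ij - A $$ ij) = 0" by (simp add: proj.hom_minus)
    thus ?thesis using proj_eq_0_iff by blast
  qed
  then obtain y where y: "B $$ ij - A $$ ij = incl (y ij)" if "ij \<in> {..<n} \<times> {..<n}" for ij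
    by metis
  have "B = A + incl_mat (mat n n y)"
  proof (rule eq_matI)
    fix i j assume "i < dim_row (A + incl_mat (mat n n y))" "j < dim_col (A + incl_mat (mat n n y))"
    hence "i < n" "j < n" by auto
    with y[of "(i, j)"] A B show "B $$ (i, j) = (A + incl_mat (mat n n y)) $$ (i, j)"
      by (simp add: algebra_simps)
  qed (use A B in auto)
  thus thesis by (intro that[of "mat n n y"]) auto
qed

text \<open>
  First-order Taylor expansion. It is exact because products with two factors from the kernel vanish,
  and the linear term only depends on the reduction of A.
\<close>

lemma power_plus_incl_mat:
  assumes A: "A \<in> carrier_mat n n" and Y: "Y \<in> carrier_mat n n"
  shows "(A + incl_mat Y) ^\<^sub>m m = A ^\<^sub>m m + incl_mat (power_deriv n m (proj_mat A) Y)"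
proof (induction m)
  case 0
  show ?case using A Y by (intro eq_matI) auto
next
  case (Suc m)
  let ?u = "proj_mat A" and ?I = "incl_mat Y"
  let ?D = "power_deriv n m ?u Y"
  have u: "?u \<in> carrier_mat n n" using A by simp
  have D: "?D \<in> carrier_mat n n" using u Y by simp
  have Am: "A ^\<^sub>m m \<in> carrier_mat n n" using A by simp
  have I: "?I \<in> carrier_mat n n" "incl_mat ?D \<in> carrier_mat n n" using Y D by auto
  have "(A + ?I) ^\<^sub>m Suc m = (A ^\<^sub>m m + incl_mat ?D) * (A + ?I)"
    by (simp add: Suc)
  also have "\<dots> = A ^\<^sub>m m * A + incl_mat ?D * A + (A ^\<^sub>m m * ?I + incl_mat ?D * ?I)"
    using A Am I by (simp add: add_mult_distrib_mat[of _ n n _ _ n] mult_add_distrib_mat[of _ n n _ n])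
  also have "incl_mat ?D * ?I = 0\<^sub>m n n"
    by (rule incl_mat_mult_incl_mat[OF D Y])
  also have "incl_mat ?D * A = incl_mat (?D * ?u)"
    by (rule incl_mat_mult_right[symmetric, OF D A])
  also have "A ^\<^sub>m m * ?I = incl_mat (?u ^\<^sub>m m * Y)"
    using incl_mat_mult_left[OF Y Am] by (simp add: proj.mat_hom_pow[OF A])
  also have "A ^\<^sub>m m * A + incl_mat (?D * ?u) + (incl_mat (?u ^\<^sub>m m * Y) + 0\<^sub>m n n) =
      A ^\<^sub>m Suc m + incl_mat (power_deriv n (Suc m) ?u Y)"
  proof -
    have "?D * ?u \<in> carrier_mat n n" "?u ^\<^sub>m m * Y \<in> carrier_mat n n"
      using D u Y by (auto intro!: mult_carrier_mat[of _ n n])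
    moreover from this have "incl_mat (?D * ?u) \<in> carrier_mat n n"
      "incl_mat (?u ^\<^sub>m m * Y) \<in> carrier_mat n n" by auto
    moreover have "A ^\<^sub>m m * A \<in> carrier_mat n n" by (rule mult_carrier_mat[OF Am A])
    ultimately show ?thesis
      by (simp add: incl_mat_add assoc_add_mat[of _ n n])
  qed
  finally show ?case .
qed

lemma prod_one_plus_incl:
  "finite S \<Longrightarrow> (\<Prod>i\<in>S. 1 + incl (f i)) = 1 + incl (\<Sum>i\<in>S. f i)"
  by (induction S rule: finite_induct) (auto simp: incl_add algebra_simps)

text \<open>
  A permutation other than the identity moves some i, and also its image; so its term in the Leibniz
  formula has two factors from the kernel and vanishes.
\<close>

lemma det_one_plus_incl_mat:
  assumes X: "X \<in> carrier_mat n n"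
  shows "det (1\<^sub>m n + incl_mat X) = 1 + incl (\<Sum>i<n. X $$ (i, i))"
proof -
  let ?A = "1\<^sub>m n + incl_mat X"
  let ?P = "{\<pi>. \<pi> permutes {0..<n}}"
  let ?t = "\<lambda>\<pi>. signof \<pi> * (\<Prod>i = 0..<n. ?A $$ (i, \<pi> i))"
  have A: "?A \<in> carrier_mat n n" using X by auto
  have zero: "?t \<pi> = 0" if \<pi>: "\<pi> \<in> ?P - {id}" for \<pi>
  proof -
    have perm: "\<pi> permutes {0..<n}" using \<pi> by simp
    obtain i where i: "\<pi> i \<noteq> i" using \<pi> by (auto simp: fun_eq_iff)
    have i': "\<pi> (\<pi> i) \<noteq> \<pi> i" using i permutes_inj[OF perm] by (auto dest: injD)
    have mem: "i \<in> {0..<n}" "\<pi> i \<in> {0..<n}" "\<pi> (\<pi> i) \<in> {0..<n}"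
      using i i' perm permutes_in_image[OF perm] by (metis permutes_not_in)+
    have "(\<Prod>j = 0..<n. ?A $$ (j, \<pi> j)) =
        ?A $$ (i, \<pi> i) * (?A $$ (\<pi> i, \<pi> (\<pi> i)) * (\<Prod>j\<in>{0..<n} - {i} - {\<pi> i}. ?A $$ (j, \<pi> j)))"
      using mem i by (subst prod.remove[of _ i], simp, simp, subst prod.remove[of _ "\<pi> i"]) auto
    also have "\<dots> = incl (X $$ (i, \<pi> i)) * incl (X $$ (\<pi> i, \<pi> (\<pi> i))) *
        (\<Prod>j\<in>{0..<n} - {i} - {\<pi> i}. ?A $$ (j, \<pi> j))"
      using mem i i' X by (simp flip: mult.assoc)
    finally show ?thesis by simp
  qed
  have "det ?A = (\<Sum>\<pi>\<in>?P. ?t \<pi>)" by (rule det_def'[OF A])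
  also have "\<dots> = ?t id + (\<Sum>\<pi>\<in>?P - {id}. ?t \<pi>)"
    by (rule sum.remove) (auto simp: finite_permutations permutes_id)
  also have "(\<Sum>\<pi>\<in>?P - {id}. ?t \<pi>) = 0" by (rule sum.neutral) (use zero in blast)
  also have "?t id = (\<Prod>i<n. 1 + incl (X $$ (i, i)))"
    using X by (auto simp: atLeast0LessThan intro!: prod.cong)
  also have "\<dots> = 1 + incl (\<Sum>i<n. X $$ (i, i))" by (rule prod_one_plus_incl) simp
  finally show ?thesis by simp
qed

definition root_fibre :: "nat \<Rightarrow> nat \<Rightarrow> 'k mat \<Rightarrow> 'r mat set" where
  "root_fibre n m u = {A \<in> SL_roots n m. proj_mat A = u}"

lemma proj_mat_SL_roots: "A \<in> SL_roots n m \<Longrightarrow> proj_mat A \<in> SL_roots n m"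
  by (auto simp: SL_roots_def proj.mat_hom_pow[symmetric] proj.mat_hom_one)

text \<open>
  The determinant condition becomes linear after multiplication by the inverse of A, which has
  determinant 1 and turns A + \<iota> Y into 1 + \<iota> (u ^ (m - 1) * Y) with u the reduction of A.
\<close>

lemma plus_incl_mat_in_SL_roots_iff:
  assumes A: "A \<in> SL_roots n m" and m: "m > 0" and Y: "Y \<in> carrier_mat n n"
  shows "A + incl_mat Y \<in> SL_roots n m \<longleftrightarrow> Y \<in> tangent_roots n m (proj_mat A)"
proof -
  let ?u = "proj_mat A"
  let ?B = "A ^\<^sub>m (m - 1)"
  have A': "A \<in> carrier_mat n n" "det A = 1" "A ^\<^sub>m m = 1\<^sub>m n" using A by (auto simp: SL_roots_def)
  have B: "?B \<in> carrier_mat n n" using A' by simp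
  have IY: "incl_mat Y \<in> carrier_mat n n" using Y by simp
  have BA: "?B * A = 1\<^sub>m n" using A' m by (cases m) auto
  have detB: "det ?B = 1" using det_mult[OF B A'(1)] A' BA by simp
  have "(A + incl_mat Y) ^\<^sub>m m = 1\<^sub>m n \<longleftrightarrow> incl_mat (power_deriv n m ?u Y) = 0\<^sub>m n n"
    (is "_ = _ \<longleftrightarrow> ?Z = _")
  proof -
    have "?Z \<in> carrier_mat n n" using A' Y by simp
    thus ?thesis unfolding power_plus_incl_mat[OF A'(1) Y] A'(3)
      by (auto simp: mat_eq_iff)
  qed
  also have "\<dots> \<longleftrightarrow> power_deriv n m ?u Y = 0\<^sub>m n n"
    by (rule incl_mat_eq_0_iff) (use A' Y in simp)
  finally have pow: "(A + incl_mat Y) ^\<^sub>m m = 1\<^sub>m n \<longleftrightarrow> power_deriv n m ?u Y = 0\<^sub>m n n" .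
  have "det (A + incl_mat Y) = det (?B * (A + incl_mat Y))"
    using A' B IY detB by (simp add: det_mult[of _ n])
  also have "?B * (A + incl_mat Y) = 1\<^sub>m n + incl_mat (?u ^\<^sub>m (m - 1) * Y)"
    using A' B IY BA incl_mat_mult_left[OF Y B]
    by (simp add: mult_add_distrib_mat[of _ n n _ n] proj.mat_hom_pow[OF A'(1)])
  also have "det \<dots> = 1 + incl (\<Sum>i<n. (?u ^\<^sub>m (m - 1) * Y) $$ (i, i))"
    by (rule det_one_plus_incl_mat) (use A' Y in auto)
  finally have "det (A + incl_mat Y) = 1 \<longleftrightarrow> (\<Sum>i<n. (?u ^\<^sub>m (m - 1) * Y) $$ (i, i)) = 0"
    by simp
  with pow A' Y show ?thesis by (auto simp: SL_roots_def tangent_roots_def)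
qed

text \<open>The right-hand side does not depend on the extension, so it allows comparing two extensions.\<close>

lemma card_root_fibre:
  assumes m: "m > 0" and ne: "root_fibre n m u \<noteq> {}"
  shows "card (root_fibre n m u) = card (tangent_roots n m u)"
proof -
  obtain A where A: "A \<in> SL_roots n m" and u: "proj_mat A = u"
    using ne by (auto simp: root_fibre_def)
  have A': "A \<in> carrier_mat n n" using A by (simp add: SL_roots_def)
  have "root_fibre n m u = (\<lambda>Y. A + incl_mat Y) ` tangent_roots n m u"
  proof (intro equalityI subsetI)
    fix B assume B: "B \<in> root_fibre n m u"
    hence "B \<in> carrier_mat n n" "proj_mat B = proj_mat A"
      using u by (auto simp: root_fibre_def SL_roots_def)
    then obtain Y where Y: "Y \<in> carrier_mat n n" "B = A + incl_mat Y"
      using same_proj_mat[OF A'] by blast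
    with B plus_incl_mat_in_SL_roots_iff[OF A m Y(1)] u
    show "B \<in> (\<lambda>Y. A + incl_mat Y) ` tangent_roots n m u"
      by (auto simp: root_fibre_def)
  next
    fix B assume "B \<in> (\<lambda>Y. A + incl_mat Y) ` tangent_roots n m u"
    then obtain Y where Y: "Y \<in> tangent_roots n m u" "B = A + incl_mat Y" by blast
    moreover have "Y \<in> carrier_mat n n" using Y by (simp add: tangent_roots_def)
    ultimately show "B \<in> root_fibre n m u"
      using plus_incl_mat_in_SL_roots_iff[OF A m] proj_mat_plus_incl_mat[OF A'] u
      by (auto simp: root_fibre_def)
  qed
  moreover have "inj_on (\<lambda>Y. A + incl_mat Y) (tangent_roots n m u)"
  proof (rule inj_onI)
    fix Y Z assume YZ: "Y \<in> tangent_roots n m u" "Z \<in> tangent_roots n m u"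
      and eq: "A + incl_mat Y = A + incl_mat Z"
    have "Y \<in> carrier_mat n n" "Z \<in> carrier_mat n n" using YZ by (auto simp: tangent_roots_def)
    thus "Y = Z" using eq A' by (auto simp: mat_eq_iff)
  qed
  ultimately show ?thesis by (simp add: card_image)
qed

end

lemma finite_carrier_mat: "finite (carrier_mat n n :: 'a::finite mat set)"
proof -
  have "carrier_mat n n \<subseteq> (\<lambda>f. mat n n f) ` (({..<n} \<times> {..<n}) \<rightarrow>\<^sub>E (UNIV :: 'a set))"
  proof
    fix A :: "'a mat" assume A: "A \<in> carrier_mat n n"
    let ?f = "restrict (\<lambda>ij. A $$ ij) ({..<n} \<times> {..<n})"
    have "A = mat n n ?f" using A by (intro eq_matI) auto
    moreover have "?f \<in> ({..<n} \<times> {..<n}) \<rightarrow>\<^sub>E UNIV" by simp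
    ultimately show "A \<in> (\<lambda>f. mat n n f) ` (({..<n} \<times> {..<n}) \<rightarrow>\<^sub>E UNIV)" by blast
  qed
  thus ?thesis by (rule finite_subset) (auto intro!: finite_imageI finite_PiE)
qed

lemma finite_SL_roots: "finite (SL_roots n m :: 'a::{finite,comm_ring_1} mat set)"
  by (rule finite_subset[OF _ finite_carrier_mat[of n]]) (auto simp: SL_roots_def)

lemma zero_in_tangent_roots:
  assumes "u \<in> carrier_mat n n"
  shows "0\<^sub>m n n \<in> tangent_roots n m u"
proof -
  have "power_deriv n k u (0\<^sub>m n n) = 0\<^sub>m n n" for k
    using assms by (induction k) auto
  thus ?thesis using assms by (auto simp: tangent_roots_def)
qed

lemma card_tangent_roots_pos:
  fixes u :: "'k::{finite,comm_ring_1} mat"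
  assumes "u \<in> carrier_mat n n"
  shows "card (tangent_roots n m u) > 0"
proof -
  have "finite (tangent_roots n m u)"
    by (rule finite_subset[OF _ finite_carrier_mat[of n]]) (auto simp: tangent_roots_def)
  thus ?thesis using zero_in_tangent_roots[OF assms, of m] by (auto simp: card_gt_0_iff)
qed

text \<open>
  The sum runs over finite fibres: each is empty or in bijection with a set of matrices over k.
\<close>

lemma card_SL_roots:
  fixes proj :: "'r::comm_ring_1 \<Rightarrow> 'k::{finite,comm_ring_1}"
  assumes ext: "square_zero_extension proj incl" and m: "m > 0"
  shows "card (SL_roots n m :: 'r mat set) =
    (\<Sum>u\<in>SL_roots n m. card (square_zero_extension.root_fibre proj n m u))"
proof -
  interpret square_zero_extension proj incl by (rule ext)
  have "finite (root_fibre n m u)" if "u \<in> SL_roots n m" for u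
  proof (cases "root_fibre n m u = {}")
    case False
    have "u \<in> carrier_mat n n" using that by (simp add: SL_roots_def)
    hence "card (root_fibre n m u) > 0"
      using card_root_fibre[OF m False] card_tangent_roots_pos by metis
    thus ?thesis by (rule card_ge_0_finite)
  qed simp
  moreover have "SL_roots n m = (\<Union>u\<in>SL_roots n m. root_fibre n m u)"
    using proj_mat_SL_roots by (auto simp: root_fibre_def)
  moreover have "root_fibre n m u \<inter> root_fibre n m v = {}" if "u \<noteq> v" for u v
    using that by (auto simp: root_fibre_def)
  ultimately show ?thesis
    using card_UN_disjoint[OF finite_SL_roots[of n m], of "root_fibre n m"] by simp
qed

section \<open>The dual numbers\<close>

lemma t2_dvd_iff: "[:0, 1:] ^ 2 dvd (f :: 'k::comm_ring_1 poly) \<longleftrightarrow> coeff f 0 = 0 \<and> coeff f 1 = 0"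
proof
  assume "[:0, 1:] ^ 2 dvd f"
  thus "coeff f 0 = 0 \<and> coeff f 1 = 0" by (auto simp: dvd_def power2_eq_square)
next
  assume f: "coeff f 0 = 0 \<and> coeff f 1 = 0"
  obtain a b g where "f = pCons a (pCons b g)" by (metis pCons_cases)
  with f have "f = [:0, 1:] ^ 2 * g" by (simp add: power2_eq_square)
  thus "[:0, 1:] ^ 2 dvd f" by simp
qed

lift_definition dual_proj :: "'k::comm_ring_1 poly_mod_t2 \<Rightarrow> 'k" is "\<lambda>f. coeff f 0"
proof -
  fix f g :: "'k poly"
  assume "[:0, 1:] ^ 2 dvd f - g"
  thus "coeff f 0 = coeff g 0" by (simp add: t2_dvd_iff)
qed

lift_definition dual_incl :: "'k::comm_ring_1 \<Rightarrow> 'k poly_mod_t2" is "\<lambda>x. [:0, x:]" .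

lift_definition dual_const :: "'k::comm_ring_1 \<Rightarrow> 'k poly_mod_t2" is "\<lambda>x. [:x:]" .

lemma dual_numbers_extension:
  "square_zero_extension (dual_proj :: 'k::comm_ring_1 poly_mod_t2 \<Rightarrow> 'k) dual_incl"
proof unfold_locales
  fix x y :: 'k and r s :: "'k poly_mod_t2"
  show "dual_proj (r + s) = dual_proj r + dual_proj s" by transfer simp
  show "dual_proj (r * s) = dual_proj r * dual_proj s" by transfer (simp add: coeff_mult)
  show "dual_proj (1 :: 'k poly_mod_t2) = 1" by transfer simp
  show "dual_incl (x + y) = dual_incl x + dual_incl y" by transfer simp
  show "dual_incl (x * dual_proj r) = dual_incl x * r"
    by transfer (auto simp: t2_dvd_iff coeff_pCons)
  show "inj (dual_incl :: 'k \<Rightarrow> _)"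
    by (rule injI, transfer) (simp add: t2_dvd_iff)
  show "dual_proj r = 0 \<longleftrightarrow> r \<in> range dual_incl"
    unfolding image_iff
  proof (transfer, safe)
    fix f :: "'k poly" assume "coeff f 0 = 0"
    thus "\<exists>x\<in>UNIV. [:0, 1:]\<^sup>2 dvd f - [:0, x:]"
      by (intro bexI[of _ "coeff f 1"]) (auto simp: t2_dvd_iff)
  qed (simp add: t2_dvd_iff)
qed (transfer; simp)+

lemma dual_const_hom: "comm_ring_hom (dual_const :: 'k::comm_ring_1 \<Rightarrow> _)"
  by unfold_locales (transfer; simp add: one_pCons)+

lemma dual_root_fibre_nonempty:
  fixes u :: "'k::comm_ring_1 mat"
  assumes u: "u \<in> SL_roots n m"
  shows "square_zero_extension.root_fibre dual_proj n m u \<noteq> {}"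
proof -
  interpret square_zero_extension "dual_proj :: 'k poly_mod_t2 \<Rightarrow> 'k" dual_incl
    by (rule dual_numbers_extension)
  interpret c: comm_ring_hom "dual_const :: 'k \<Rightarrow> _" by (rule dual_const_hom)
  have "dual_proj (dual_const x) = x" for x :: 'k by transfer simp
  hence "proj_mat (map_mat dual_const u) = u" by (intro eq_matI) auto
  moreover have "map_mat dual_const u \<in> SL_roots n m"
    using u by (auto simp: SL_roots_def c.mat_hom_pow[symmetric] c.mat_hom_one)
  ultimately show ?thesis by (auto simp: root_fibre_def)
qed

section \<open>Witt vectors of length two\<close>

definition witt_proj :: "'k witt2 \<Rightarrow> 'k" where
  "witt_proj r = fst (wcomps r)"

text \<open>
  The ideal of the (0, y) is a module over k by way of the Frobenius map, since
  (0, y) * (a, b) = (0, y * a ^ p). Taking p-th powers undoes this twist and makes the map linear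
  over k; it maps x to p times any lift of x.
\<close>

definition witt_incl :: "'k::comm_ring_prime_char \<Rightarrow> 'k witt2" where
  "witt_incl x = Witt2 (0, x ^ CHAR('k))"

lemma frobenius_add:
  fixes x y :: "'k::comm_ring_prime_char"
  shows "(x + y) ^ CHAR('k) = x ^ CHAR('k) + y ^ CHAR('k)"
  by (simp add: add_power_prime_eq)

lemma inj_frobenius: "inj (\<lambda>x :: 'k::field_prime_char. x ^ CHAR('k))"
proof (rule injI)
  fix x y :: 'k assume "x ^ CHAR('k) = y ^ CHAR('k)"
  moreover have "x ^ CHAR('k) = (x - y) ^ CHAR('k) + y ^ CHAR('k)"
    using frobenius_add[of "x - y" y] by simp
  ultimately show "x = y" by simp
qed

lemma witt_extension:
  "square_zero_extension (witt_proj :: 'k::finite_field witt2 \<Rightarrow> 'k) witt_incl"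
proof -
  have CHAR_pos: "CHAR('k) > 0" using prime_gt_0_nat[of "CHAR('k)"] by simp
  have surj: "surj (\<lambda>x :: 'k. x ^ CHAR('k))"
    by (rule finite_UNIV_inj_surj[OF _ inj_frobenius]) simp
  note defs = witt_proj_def witt_incl_def plus_witt2_def times_witt2_def zero_witt2_def
    one_witt2_def witt_add_def witt_mult_def
  show ?thesis
  proof unfold_locales
    fix x y :: 'k and r s :: "'k witt2"
    show "witt_incl (x + y) = witt_incl x + witt_incl y" by (simp add: defs frobenius_add)
    show "witt_incl (x * witt_proj r) = witt_incl x * r"
      using CHAR_pos by (simp add: defs power_mult_distrib)
    show "inj (witt_incl :: 'k \<Rightarrow> _)"
      using inj_frobenius by (auto simp: inj_def witt_incl_def)
    show "witt_proj r = 0 \<longleftrightarrow> r \<in> range witt_incl"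
    proof
      assume r: "witt_proj r = 0"
      obtain x where "snd (wcomps r) = x ^ CHAR('k)" using surj by (metis surjD)
      hence "r = witt_incl x" using r by (cases r) (auto simp: witt_incl_def witt_proj_def)
      thus "r \<in> range witt_incl" by blast
    qed (auto simp: witt_incl_def witt_proj_def)
  qed (simp_all add: defs)
qed

text \<open>
  Over the integers, m has the ghost components m and m, hence the Witt components m and
  (m - m ^ p) / p.
\<close>

lemma of_nat_witt2:
  "\<exists>c::int. (of_nat m :: 'k::comm_ring_prime_char witt2) = Witt2 (of_nat m, of_int c) \<and>
     int CHAR('k) * c = int m - int m ^ CHAR('k)"
proof (induction m)
  case 0
  have "CHAR('k) > 0" using prime_gt_0_nat[of "CHAR('k)"] by simp
  thus ?case by (intro exI[of _ 0]) (simp add: zero_witt2_def)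
next
  case (Suc m)
  let ?p = "CHAR('k)"
  obtain c :: int where c: "(of_nat m :: 'k witt2) = Witt2 (of_nat m, of_int c)"
    "int ?p * c = int m - int m ^ ?p" using Suc by blast
  let ?d = "c - witt_carry ?p 1 (int m)"
  have "(of_nat (Suc m) :: 'k witt2) = Witt2 (of_nat (Suc m), of_int ?d)"
    by (simp add: c plus_witt2_def one_witt2_def witt_add_def of_int_hom.hom_witt_carry)
  moreover have "int ?p * ?d = int (Suc m) - int (Suc m) ^ ?p"
    using add_power_prime_eq[of ?p 1 "int m"] c(2) by (simp add: algebra_simps)
  ultimately show ?case by blast
qed

text \<open>
  The second component of p is 1 - p ^ (p - 1), which is 1 in characteristic p. So p is nonzero in
  the Witt vectors, in contrast to the dual numbers, where p = 0.
\<close>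

lemma of_nat_CHAR_witt2: "(of_nat CHAR('k) :: 'k::comm_ring_prime_char witt2) = witt_incl 1"
proof -
  let ?p = "CHAR('k)"
  have p: "prime ?p" by simp
  obtain c :: int where c: "(of_nat ?p :: 'k witt2) = Witt2 (of_nat ?p, of_int c)"
    "int ?p * c = int ?p - int ?p ^ ?p" using of_nat_witt2[of ?p] by blast
  obtain k where k: "?p = Suc (Suc k)" using prime_ge_2_nat[OF p] by (metis add_2_eq_Suc le_Suc_ex)
  have "int ?p * c = int ?p * (1 - int ?p ^ Suc k)"
    unfolding c(2) by (subst (3) k) (simp add: right_diff_distrib)
  hence "c = 1 - int ?p ^ Suc k" using p by (auto simp: prime_gt_0_nat)
  hence "(of_int c :: 'k) = 1" by simp
  with c(1) show ?thesis by (simp add: witt_incl_def)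
qed

text \<open>
  The p-th power of a lift of 1 + N is 1 + p * N whichever lift is chosen, because the derivative of
  the p-th power map vanishes at the reduction of 1 + N.
\<close>

lemma witt_root_fibre_empty:
  fixes N :: "'k::finite_field witt2 mat"
  assumes N: "N \<in> carrier_mat n n" and N2: "N * N = 0\<^sub>m n n"
    and N0: "map_mat witt_proj N \<noteq> 0\<^sub>m n n" and p: "CHAR('k) \<ge> 5"
  shows "square_zero_extension.root_fibre witt_proj n CHAR('k) (1\<^sub>m n + map_mat witt_proj N) = {}"
proof -
  interpret square_zero_extension "witt_proj :: 'k witt2 \<Rightarrow> 'k" witt_incl by (rule witt_extension)
  let ?p = "CHAR('k)" and ?M = "map_mat witt_proj N"
  have M: "?M \<in> carrier_mat n n" using N by simp
  have M2: "?M * ?M = 0\<^sub>m n n"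
    using proj.mat_hom_mult[OF N N] N2 by (auto simp: mat_eq_iff)
  have proj_eq: "proj_mat (1\<^sub>m n + N) = 1\<^sub>m n + ?M"
    using N by (intro eq_matI) (auto simp: proj.hom_add)
  have pN: "of_nat ?p \<cdot>\<^sub>m N = incl_mat ?M"
    using N by (intro eq_matI) (auto simp: of_nat_CHAR_witt2 incl_proj[symmetric])
  have False if B: "B \<in> root_fibre n ?p (1\<^sub>m n + ?M)" for B
  proof -
    have B': "B \<in> carrier_mat n n" "B ^\<^sub>m ?p = 1\<^sub>m n" "proj_mat B = proj_mat (1\<^sub>m n + N)"
      using B by (auto simp: root_fibre_def SL_roots_def proj_eq)
    have oneN: "1\<^sub>m n + N \<in> carrier_mat n n" using N by simp
    obtain Y where Y: "Y \<in> carrier_mat n n" "B = 1\<^sub>m n + N + incl_mat Y"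
      using same_proj_mat[OF oneN B'(1,3)] by blast
    have "B ^\<^sub>m ?p = 1\<^sub>m n + of_nat ?p \<cdot>\<^sub>m N + incl_mat (power_deriv n ?p (1\<^sub>m n + ?M) Y)"
      unfolding Y(2) power_plus_incl_mat[OF oneN Y(1)] power_one_plus_square_zero[OF N N2] proj_eq ..
    also have "power_deriv n ?p (1\<^sub>m n + ?M) Y = 0\<^sub>m n n"
      by (rule power_deriv_CHAR_eq_0[OF M M2 Y(1)]) (use p in auto)
    also have "1\<^sub>m n + of_nat ?p \<cdot>\<^sub>m N + incl_mat (0\<^sub>m n n) = 1\<^sub>m n + incl_mat ?M"
      unfolding pN using N by (intro eq_matI) auto
    finally have "1\<^sub>m n + incl_mat ?M = 1\<^sub>m n" using B'(2) by simp
    hence "incl_mat ?M = 0\<^sub>m n n" using N by (auto simp: mat_eq_iff)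
    thus False using incl_mat_eq_0_iff[OF M] N0 by simp
  qed
  thus ?thesis by blast
qed

lemma transvection_in_SL_roots:
  fixes N :: "'k::comm_ring_1 mat"
  assumes N: "N \<in> carrier_mat n n" and N2: "N * N = 0\<^sub>m n n" and d: "det (1\<^sub>m n + N) = 1"
  shows "1\<^sub>m n + N \<in> SL_roots n CHAR('k)"
  using N d by (auto simp: SL_roots_def power_one_plus_square_zero[OF N N2] intro!: eq_matI)

lemma card_SL_roots_witt2_less:
  assumes n: "n \<ge> 2" and p: "CHAR('k::finite_field) \<ge> 5"
  shows "card (SL_roots n CHAR('k) :: 'k witt2 mat set)
    < card (SL_roots n CHAR('k) :: 'k poly_mod_t2 mat set)"
proof -
  interpret W: square_zero_extension "witt_proj :: 'k witt2 \<Rightarrow> 'k" witt_incl by (rule witt_extension)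
  interpret D: square_zero_extension "dual_proj :: 'k poly_mod_t2 \<Rightarrow> 'k" dual_incl
    by (rule dual_numbers_extension)
  let ?p = "CHAR('k)"
  have p0: "?p > 0" using p by simp
  define N :: "'k witt2 mat" where "N = mat n n (\<lambda>ij. if ij = (0, 1) then 1 else 0)"
  have N: "N \<in> carrier_mat n n" by (simp add: N_def)
  have N2: "N * N = 0\<^sub>m n n"
    by (intro eq_matI) (auto simp: N_def scalar_prod_def intro!: sum.neutral)
  let ?M = "map_mat witt_proj N" and ?u = "1\<^sub>m n + map_mat witt_proj N"
  have M: "?M \<in> carrier_mat n n" using N by simp
  have M2: "?M * ?M = 0\<^sub>m n n"
    using W.proj.mat_hom_mult[OF N N] N2 by (auto simp: mat_eq_iff)
  have M0: "?M \<noteq> 0\<^sub>m n n"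
  proof
    assume "?M = 0\<^sub>m n n"
    hence "?M $$ (0, 1) = 0\<^sub>m n n $$ (0, 1)" by simp
    thus False using n by (simp add: N_def)
  qed
  have "upper_triangular ?u"
    unfolding upper_triangular_def using N by (auto simp: N_def)
  hence "det ?u = prod_list (diag_mat ?u)" by (rule det_upper_triangular) (use N in auto)
  also have "diag_mat ?u = replicate n 1"
    using N by (intro nth_equalityI) (auto simp: diag_mat_def N_def)
  finally have u: "?u \<in> SL_roots n ?p"
    by (intro transvection_in_SL_roots[OF M M2]) simp
  have "card (W.root_fibre n ?p v) \<le> card (tangent_roots n ?p v)" for v
    using W.card_root_fibre[OF p0, of n v] by (cases "W.root_fibre n ?p v = {}") auto
  moreover have "card (W.root_fibre n ?p ?u) < card (tangent_roots n ?p ?u)"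
    unfolding witt_root_fibre_empty[OF N N2 M0 p] using card_tangent_roots_pos[of ?u n ?p] N by simp
  ultimately have "(\<Sum>v\<in>SL_roots n ?p. card (W.root_fibre n ?p v)) <
      (\<Sum>v\<in>SL_roots n ?p. card (tangent_roots n ?p (v :: 'k mat)))"
    using u by (auto intro!: sum_strict_mono_ex1 finite_SL_roots)
  also have "\<dots> = (\<Sum>v\<in>SL_roots n ?p. card (D.root_fibre n ?p v))"
    by (intro sum.cong refl D.card_root_fibre[OF p0, symmetric] dual_root_fibre_nonempty)
  finally show ?thesis
    unfolding card_SL_roots[OF witt_extension p0] card_SL_roots[OF dual_numbers_extension p0] .
qed

section \<open>The isomorphism invariant\<close>

lemma SL_nat_pow:
  assumes "A \<in> carrier (SL n TYPE('r::comm_ring_1))"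
  shows "A [^]\<^bsub>SL n TYPE('r)\<^esub> (m::nat) = A ^\<^sub>m m"
proof (induction m)
  case 0
  show ?case using assms by (auto simp: SL_def nat_pow_def)
next
  case (Suc m)
  have "A [^]\<^bsub>SL n TYPE('r)\<^esub> Suc m = A [^]\<^bsub>SL n TYPE('r)\<^esub> m * A"
    by (simp add: nat_pow_def SL_def)
  thus ?case by (simp add: Suc)
qed

lemma SL_roots_eq:
  "SL_roots n m = {x \<in> carrier (SL n TYPE('r::comm_ring_1)).
     x [^]\<^bsub>SL n TYPE('r)\<^esub> m = \<one>\<^bsub>SL n TYPE('r)\<^esub>}" (is "_ = ?R")
proof -
  have "?R = {x \<in> carrier (SL n TYPE('r)). x ^\<^sub>m m = 1\<^sub>m n}"
    using SL_nat_pow[where 'r = 'r] by (auto simp: SL_def)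
  thus ?thesis by (auto simp: SL_roots_def SL_def)
qed

lemma card_roots_of_unity_iso:
  assumes G: "group G" and H: "group H" and iso: "G \<cong> H"
  shows "card {x \<in> carrier G. x [^]\<^bsub>G\<^esub> (m::nat) = \<one>\<^bsub>G\<^esub>} =
    card {x \<in> carrier H. x [^]\<^bsub>H\<^esub> m = \<one>\<^bsub>H\<^esub>}"
proof -
  obtain h where h: "h \<in> iso G H" using iso by (auto simp: is_iso_def)
  interpret group_hom G H h
    using G H h by (intro group_hom.intro) (auto simp: group_hom_axioms_def iso_def)
  have bij: "bij_betw h (carrier G) (carrier H)" using h by (simp add: iso_def)
  have "h x [^]\<^bsub>H\<^esub> m = \<one>\<^bsub>H\<^esub> \<longleftrightarrow> x [^]\<^bsub>G\<^esub> m = \<one>\<^bsub>G\<^esub>" if x: "x \<in> carrier G" for x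
    using bij x hom_nat_pow[OF x, of m] hom_one G.nat_pow_closed[OF x] G.one_closed
    by (metis bij_betw_imp_inj_on inj_onD)
  hence "h ` {x \<in> carrier G. x [^]\<^bsub>G\<^esub> m = \<one>\<^bsub>G\<^esub>} =
      {x \<in> h ` carrier G. x [^]\<^bsub>H\<^esub> m = \<one>\<^bsub>H\<^esub>}"
    by auto
  hence "bij_betw h {x \<in> carrier G. x [^]\<^bsub>G\<^esub> m = \<one>\<^bsub>G\<^esub>}
      {x \<in> carrier H. x [^]\<^bsub>H\<^esub> m = \<one>\<^bsub>H\<^esub>}"
    using bij by (auto intro: bij_betw_subset simp: bij_betw_imp_surj_on)
  thus ?thesis by (rule bij_betw_same_card)
qed

theorem mainTheorem4:
  fixes n :: nat
  assumes "n \<ge> 2"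
    and "CHAR('a::finite_field) \<ge> 5"
  shows "\<not> (SL n TYPE('a witt2) \<cong> SL n TYPE('a poly_mod_t2))"
proof
  assume "SL n TYPE('a witt2) \<cong> SL n TYPE('a poly_mod_t2)"
  hence "card (SL_roots n CHAR('a) :: 'a witt2 mat set)
      = card (SL_roots n CHAR('a) :: 'a poly_mod_t2 mat set)"
    unfolding SL_roots_eq by (rule card_roots_of_unity_iso[OF group_SL group_SL])
  with card_SL_roots_witt2_less[OF assms] show False by simp
qed

end
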